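(* Let $G$ be a group and let $H_1$ and $H_2$ be two proper subgroups of $G$ which are isomorphic via an isomorphism $\phi:H_1\to H_2$. Let $$G_*=\langle G,t\mid t^{-1}ht=\phi(h),\ h\in H_1\rangle$$ be the HNN extension of $G$ via $\phi$. Then for every integer $m\ge 0$, the $m$-almost palindromic width $\mathrm{pw}_m(G_*,\,G\cup\{t,t^{-1}\})$ of $G_*$ with respect to the generating set $G\cup\{t,t^{-1}\}$ is infinite.
   Context: Let $K$ be a group with generating set $X$. A reduced word $w$ in the alphabet $X^{\pm1}$ is called a palindrome if it reads the same left-to-right and right-to-left. An element $g\in K$ is called a palindrome if there exists a word in $X^{\pm1}$ representing $g$ that is a palindrome. For an integer $m\ge 0$, an element $g\in K$ is an $m$-almost palindrome if some word in $X^{\pm1}$ representing $g$ differs from a palindrome by a change of at most $m$ letters in $X^{\pm1}$. $\mathcal{P}_m(X)$ denotes the set of all $m$-almost palindromes in $K$. The $m$-almost palindromic length $l_{\mathcal{P}_m}(g)$ of $g\in K$ is the minimum $k$ such that $g=p_1p_2\cdots p_k$ with each $p_i\in\mathcal{P}_m(X)$. The $m$-almost palindromic width of $K$ with respect to $X$ is $\mathrm{pw}_m(K,X)=\sup_{g\in K} l_{\mathcal{P}_m}(g)$.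
   Formalization: "Reduced word" is read as reduced in the HNN (Britton) sense: no two adjacent letters of G, no t^{-1}ht with h in H_1, no tht^{-1} with h in H_2, no tt^{-1} or t^{-1}t. With merely freely reduced words the claim fails, e.g. for G=A_5, H_1=H_2=1 (width at most 2). *)

theory Defs
  imports "HOL-Algebra.Group" "HOL-Library.Extended_Nat" "HOL-Library.Sublist"
begin

subsection \<open>Groups given by presentations\<close>

text \<open>A word over formal letters \<open>x\<close> and \<open>x\<^sup>-\<^sup>1\<close>, encoded as \<open>(x, True)\<close> and \<open>(x, False)\<close>.\<close>

type_synonym 'x pword = "('x \<times> bool) list"

abbreviation pwords :: "'x set \<Rightarrow> 'x pword set"
  where "pwords S \<equiv> lists (S \<times> UNIV)"

text \<open>The congruence on words generated by free cancellation and by the defining relations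
  \<open>l = r\<close>, for \<open>(l, r) \<in> R\<close>.\<close>

inductive_set pres_rel :: "'x set \<Rightarrow> ('x pword \<times> 'x pword) set \<Rightarrow> ('x pword \<times> 'x pword) set"
  for S R where
  refl: "w \<in> pwords S \<Longrightarrow> (w, w) \<in> pres_rel S R"
| sym: "(u, v) \<in> pres_rel S R \<Longrightarrow> (v, u) \<in> pres_rel S R"
| trans: "(u, v) \<in> pres_rel S R \<Longrightarrow> (v, w) \<in> pres_rel S R \<Longrightarrow> (u, w) \<in> pres_rel S R"
| cancel: "x \<in> S \<Longrightarrow> u \<in> pwords S \<Longrightarrow> v \<in> pwords S
    \<Longrightarrow> (u @ [(x, b), (x, \<not> b)] @ v, u @ v) \<in> pres_rel S R"
| relation: "(l, r) \<in> R \<Longrightarrow> u @ l @ v \<in> pwords S \<Longrightarrow> u @ r @ v \<in> pwords S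
    \<Longrightarrow> (u @ l @ v, u @ r @ v) \<in> pres_rel S R"

definition pres_class :: "'x set \<Rightarrow> ('x pword \<times> 'x pword) set \<Rightarrow> 'x pword \<Rightarrow> 'x pword set"
  where "pres_class S R w = pres_rel S R `` {w}"

definition pres_group :: "'x set \<Rightarrow> ('x pword \<times> 'x pword) set \<Rightarrow> 'x pword set monoid"
  where "pres_group S R =
    \<lparr>carrier = pwords S // pres_rel S R,
     monoid.mult = (\<lambda>A B. \<Union>u\<in>A. \<Union>v\<in>B. pres_class S R (u @ v)),
     one = pres_class S R []\<rparr>"


subsection \<open>HNN extensions\<close>

datatype 'a hnn_gen = Base 'a | Stable

text \<open>\<open>\<langle>G, t | t\<^sup>-\<^sup>1ht = \<phi>(h), h \<in> H\<rangle>\<close>, with \<open>G\<close> presented by its multiplication table.\<close>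

definition hnn_gens :: "('a, 'b) monoid_scheme \<Rightarrow> 'a hnn_gen set"
  where "hnn_gens G = insert Stable (Base ` carrier G)"

definition hnn_rels :: "('a, 'b) monoid_scheme \<Rightarrow> 'a set \<Rightarrow> ('a \<Rightarrow> 'a)
    \<Rightarrow> ('a hnn_gen pword \<times> 'a hnn_gen pword) set"
  where "hnn_rels G H \<phi> =
    {([(Base g, True), (Base h, True)], [(Base (g \<otimes>\<^bsub>G\<^esub> h), True)]) | g h.
        g \<in> carrier G \<and> h \<in> carrier G} \<union>
    {([(Stable, False), (Base h, True), (Stable, True)], [(Base (\<phi> h), True)]) | h. h \<in> H}"

definition HNN :: "('a, 'b) monoid_scheme \<Rightarrow> 'a set \<Rightarrow> ('a \<Rightarrow> 'a) \<Rightarrow> 'a hnn_gen pword set monoid"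
  where "HNN G H \<phi> = pres_group (hnn_gens G) (hnn_rels G H \<phi>)"

definition hnn_base ::
    "('a, 'b) monoid_scheme \<Rightarrow> 'a set \<Rightarrow> ('a \<Rightarrow> 'a) \<Rightarrow> 'a \<Rightarrow> 'a hnn_gen pword set"
  where "hnn_base G H \<phi> g = pres_class (hnn_gens G) (hnn_rels G H \<phi>) [(Base g, True)]"

definition hnn_stable ::
    "('a, 'b) monoid_scheme \<Rightarrow> 'a set \<Rightarrow> ('a \<Rightarrow> 'a) \<Rightarrow> 'a hnn_gen pword set"
  where "hnn_stable G H \<phi> = pres_class (hnn_gens G) (hnn_rels G H \<phi>) [(Stable, True)]"

definition hnn_genset ::
    "('a, 'b) monoid_scheme \<Rightarrow> 'a set \<Rightarrow> ('a \<Rightarrow> 'a) \<Rightarrow> 'a hnn_gen pword set set"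
  where "hnn_genset G H \<phi> =
    hnn_base G H \<phi> ` carrier G \<union> {hnn_stable G H \<phi>, inv\<^bsub>HNN G H \<phi>\<^esub> (hnn_stable G H \<phi>)}"

text \<open>Reduced words over \<open>G \<union> {t, t\<^sup>-\<^sup>1}\<close> are the words
  \<open>g\<^sub>0 t\<^bsup>e\<^sub>1\<^esup> g\<^sub>1 \<dots> t\<^bsup>e\<^sub>n\<^esup> g\<^sub>n\<close> of Britton's lemma: letters of \<open>G\<close> do not occur next to each
  other, and there is no subword \<open>t\<^sup>-\<^sup>1 h t\<close> with \<open>h \<in> H\<^sub>1\<close> or \<open>t h t\<^sup>-\<^sup>1\<close> with \<open>h \<in> H\<^sub>2\<close>. A factor
  \<open>g\<^sub>i = 1\<close> may be written or left out; hence \<open>t\<^sup>-\<^sup>1 t\<close> and \<open>t t\<^sup>-\<^sup>1\<close> are excluded as well.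
  Reducedness in the free group on \<open>G \<union> {t, t\<^sup>-\<^sup>1}\<close> would be too weak a condition here: it admits
  arbitrary products of letters of \<open>G\<close>, and if, say, \<open>G\<close> is perfect, then every element of
  \<open>HNN G {\<one>} id\<close> is a product of two values of freely reduced palindromes.\<close>

definition hnn_reduced :: "('a, 'b) monoid_scheme \<Rightarrow> 'a set \<Rightarrow> 'a set \<Rightarrow> ('a \<Rightarrow> 'a)
    \<Rightarrow> 'a hnn_gen pword set list \<Rightarrow> bool"
  where "hnn_reduced G H1 H2 \<phi> w \<longleftrightarrow>
    (let base = hnn_base G H1 \<phi>; t = hnn_stable G H1 \<phi>; t' = inv\<^bsub>HNN G H1 \<phi>\<^esub> t in
      (\<forall>g\<in>carrier G. \<forall>h\<in>carrier G. \<not> sublist [base g, base h] w) \<and>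
      \<not> sublist [t', t] w \<and> \<not> sublist [t, t'] w \<and>
      (\<forall>h\<in>H1. \<not> sublist [t', base h, t] w) \<and>
      (\<forall>h\<in>H2. \<not> sublist [t, base h, t'] w))"


subsection \<open>Almost palindromes and almost palindromic width\<close>

text \<open>Words in \<open>X\<^sup>\<plusminus>\<^sup>1\<close> are lists of elements of \<open>X \<union> X\<^sup>-\<^sup>1\<close>. The meaning of ``reduced word'' depends
  on the kind of group at hand, so it is passed as the parameter \<open>red\<close>.\<close>

definition letters :: "('k, 'c) monoid_scheme \<Rightarrow> 'k set \<Rightarrow> 'k set"
  where "letters K X = X \<union> (\<lambda>x. inv\<^bsub>K\<^esub> x) ` X"

definition word_prod :: "('k, 'c) monoid_scheme \<Rightarrow> 'k list \<Rightarrow> 'k"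
  where "word_prod K w = foldr (\<lambda>x y. x \<otimes>\<^bsub>K\<^esub> y) w \<one>\<^bsub>K\<^esub>"

definition palindromes :: "('k, 'c) monoid_scheme \<Rightarrow> 'k set \<Rightarrow> ('k list \<Rightarrow> bool) \<Rightarrow> 'k list set"
  where "palindromes K X red = {p \<in> lists (letters K X). red p \<and> rev p = p}"

definition letter_changes :: "'k list \<Rightarrow> 'k list \<Rightarrow> nat"
  where "letter_changes w p = card {i. i < length w \<and> w ! i \<noteq> p ! i}"

definition almost_palindromes ::
    "('k, 'c) monoid_scheme \<Rightarrow> 'k set \<Rightarrow> ('k list \<Rightarrow> bool) \<Rightarrow> nat \<Rightarrow> 'k set"
  where "almost_palindromes K X red m =
    {word_prod K w | w. w \<in> lists (letters K X) \<and>
      (\<exists>p\<in>palindromes K X red. length p = length w \<and> letter_changes w p \<le> m)}"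

definition almost_pal_length ::
    "('k, 'c) monoid_scheme \<Rightarrow> 'k set \<Rightarrow> ('k list \<Rightarrow> bool) \<Rightarrow> nat \<Rightarrow> 'k \<Rightarrow> enat"
  where "almost_pal_length K X red m g =
    (INF ps\<in>{ps \<in> lists (almost_palindromes K X red m). word_prod K ps = g}. enat (length ps))"

definition almost_pal_width ::
    "('k, 'c) monoid_scheme \<Rightarrow> 'k set \<Rightarrow> ('k list \<Rightarrow> bool) \<Rightarrow> nat \<Rightarrow> enat"
  where "almost_pal_width K X red m = (SUP g\<in>carrier K. almost_pal_length K X red m g)"


subsection \<open>Basic facts\<close>

lemma pres_rel_words: "(u, v) \<in> pres_rel S R \<Longrightarrow> u \<in> pwords S \<and> v \<in> pwords S"
  by (induction rule: pres_rel.induct) auto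

lemma equiv_pres_rel: "equiv (pwords S) (pres_rel S R)"
proof (rule equivI)
  show "pres_rel S R \<subseteq> pwords S \<times> pwords S" using pres_rel_words by fastforce
  show "refl_on (pwords S) (pres_rel S R)" by (auto simp: refl_on_def intro: pres_rel.refl)
  show "sym (pres_rel S R)" by (auto simp: sym_def intro: pres_rel.sym)
  show "trans (pres_rel S R)" by (rule transI) (rule pres_rel.trans)
qed

lemma pres_rel_context:
  assumes "(u, v) \<in> pres_rel S R" "p \<in> pwords S" "q \<in> pwords S"
  shows "(p @ u @ q, p @ v @ q) \<in> pres_rel S R"
  using assms
proof (induction rule: pres_rel.induct)
  case (refl w)
  then show ?case by (intro pres_rel.refl) simp
next
  case (sym u v)
  then show ?case by (blast intro: pres_rel.sym)
next
  case (trans u v w)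
  then show ?case by (meson pres_rel.trans)
next
  case (cancel x u v b)
  then show ?case using pres_rel.cancel[of x S "p @ u" "v @ q" b R] by simp
next
  case (relation l r u v)
  then show ?case using pres_rel.relation[of l r R "p @ u" "v @ q" S] by simp
qed

lemma pres_rel_append:
  assumes "(u, u') \<in> pres_rel S R" "(v, v') \<in> pres_rel S R"
  shows "(u @ v, u' @ v') \<in> pres_rel S R"
proof -
  have "(u @ v, u' @ v) \<in> pres_rel S R"
    using pres_rel_context[OF assms(1), of "[]" v] assms(2) pres_rel_words by fastforce
  moreover have "(u' @ v, u' @ v') \<in> pres_rel S R"
    using pres_rel_context[OF assms(2), of u' "[]"] assms(1) pres_rel_words by fastforce
  ultimately show ?thesis by (rule pres_rel.trans)
qed

lemma pres_class_eq_iff: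
  "u \<in> pwords S \<Longrightarrow> v \<in> pwords S \<Longrightarrow>
    pres_class S R u = pres_class S R v \<longleftrightarrow> (u, v) \<in> pres_rel S R"
  unfolding pres_class_def by (rule eq_equiv_class_iff[OF equiv_pres_rel])

lemma carrier_pres_group: "carrier (pres_group S R) = pres_class S R ` pwords S"
  by (auto simp: pres_group_def quotient_def pres_class_def)

lemma pres_class_closed: "w \<in> pwords S \<Longrightarrow> pres_class S R w \<in> carrier (pres_group S R)"
  unfolding carrier_pres_group by (rule imageI)

lemma one_pres_group: "\<one>\<^bsub>pres_group S R\<^esub> = pres_class S R []"
  by (simp add: pres_group_def)

lemma mult_pres_class:
  assumes "u \<in> pwords S" "v \<in> pwords S"
  shows "pres_class S R u \<otimes>\<^bsub>pres_group S R\<^esub> pres_class S R v = pres_class S R (u @ v)"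
proof -
  have eq: "pres_class S R (u' @ v') = pres_class S R (u @ v)"
    if "u' \<in> pres_class S R u" "v' \<in> pres_class S R v" for u' v'
  proof -
    have "(u @ v, u' @ v') \<in> pres_rel S R"
      using that by (intro pres_rel_append) (auto simp: pres_class_def)
    then show ?thesis
      using pres_class_eq_iff pres_rel_words by metis
  qed
  have ne: "u \<in> pres_class S R u" "v \<in> pres_class S R v"
    using assms by (auto simp: pres_class_def intro: pres_rel.refl)
  have "(\<Union>u'\<in>pres_class S R u. \<Union>v'\<in>pres_class S R v. pres_class S R (u' @ v')) =
      (\<Union>u'\<in>pres_class S R u. \<Union>v'\<in>pres_class S R v. pres_class S R (u @ v))"
    by (intro SUP_cong HOL.refl eq)
  also have "\<dots> = pres_class S R (u @ v)"
    using ne by (subst UN_constant, subst UN_constant) auto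
  finally show ?thesis by (simp add: pres_group_def)
qed

definition pinv :: "'x pword \<Rightarrow> 'x pword"
  where "pinv w = rev (map (\<lambda>(x, b). (x, \<not> b)) w)"

lemma pinv_words: "w \<in> pwords S \<Longrightarrow> pinv w \<in> pwords S"
  by (auto simp: pinv_def)

lemma pinv_left: "w \<in> pwords S \<Longrightarrow> (pinv w @ w, []) \<in> pres_rel S R"
proof (induction w)
  case Nil
  then show ?case by (auto simp: pinv_def intro: pres_rel.refl)
next
  case (Cons a w)
  obtain x b where a: "a = (x, b)" by force
  have w: "w \<in> pwords S" "x \<in> S" using Cons.prems a by auto
  have "(pinv w @ [(x, \<not> b), (x, \<not> \<not> b)] @ w, pinv w @ w) \<in> pres_rel S R"
    using w by (intro pres_rel.cancel pinv_words)
  moreover have "pinv (a # w) @ a # w = pinv w @ [(x, \<not> b), (x, \<not> \<not> b)] @ w"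
    by (simp add: pinv_def a)
  ultimately show ?case using pres_rel.trans[OF _ Cons.IH[OF w(1)]] by metis
qed

lemma group_pres_group: "group (pres_group S R)"
proof (rule groupI)
  fix x y z
  assume "x \<in> carrier (pres_group S R)" "y \<in> carrier (pres_group S R)"
    "z \<in> carrier (pres_group S R)"
  then obtain u v w where "u \<in> pwords S" "v \<in> pwords S" "w \<in> pwords S"
    "x = pres_class S R u" "y = pres_class S R v" "z = pres_class S R w"
    by (auto simp: carrier_pres_group)
  then show "x \<otimes>\<^bsub>pres_group S R\<^esub> y \<otimes>\<^bsub>pres_group S R\<^esub> z =
      x \<otimes>\<^bsub>pres_group S R\<^esub> (y \<otimes>\<^bsub>pres_group S R\<^esub> z)"
    by (simp add: mult_pres_class del: in_lists_conv_set)
next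
  fix x assume "x \<in> carrier (pres_group S R)"
  then obtain u where u: "u \<in> pwords S" "x = pres_class S R u"
    by (auto simp: carrier_pres_group)
  have "pres_class S R (pinv u) \<otimes>\<^bsub>pres_group S R\<^esub> x = \<one>\<^bsub>pres_group S R\<^esub>"
    using u pinv_left[of u S R] pinv_words[of u S] pres_class_eq_iff[of "pinv u @ u" S "[]" R]
    by (simp add: mult_pres_class one_pres_group del: in_lists_conv_set)
  then show "\<exists>y\<in>carrier (pres_group S R). y \<otimes>\<^bsub>pres_group S R\<^esub> x = \<one>\<^bsub>pres_group S R\<^esub>"
    using pinv_words[OF u(1)] unfolding carrier_pres_group by blast
next
  fix x y assume "x \<in> carrier (pres_group S R)" "y \<in> carrier (pres_group S R)"
  then obtain u v where uv: "u \<in> pwords S" "v \<in> pwords S"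
    "x = pres_class S R u" "y = pres_class S R v"
    by (auto simp: carrier_pres_group)
  have "u @ v \<in> pwords S" using uv by simp
  then show "x \<otimes>\<^bsub>pres_group S R\<^esub> y \<in> carrier (pres_group S R)"
    unfolding carrier_pres_group uv(3,4) mult_pres_class[OF uv(1,2)] by (rule imageI)
next
  show "\<one>\<^bsub>pres_group S R\<^esub> \<in> carrier (pres_group S R)"
    by (simp add: carrier_pres_group one_pres_group)
next
  fix x assume "x \<in> carrier (pres_group S R)"
  then obtain u where u: "u \<in> pwords S" "x = pres_class S R u"
    by (auto simp: carrier_pres_group)
  show "\<one>\<^bsub>pres_group S R\<^esub> \<otimes>\<^bsub>pres_group S R\<^esub> x = x"
    unfolding one_pres_group u(2) using mult_pres_class[of "[]" S u R] u(1) by simp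
qed

lemma group_HNN: "group (HNN G H \<phi>)"
  by (simp add: HNN_def group_pres_group)

lemma hnn_base_closed: "g \<in> carrier G \<Longrightarrow> hnn_base G H \<phi> g \<in> carrier (HNN G H \<phi>)"
  unfolding hnn_base_def HNN_def by (rule pres_class_closed) (simp add: hnn_gens_def)

lemma hnn_stable_closed: "hnn_stable G H \<phi> \<in> carrier (HNN G H \<phi>)"
  unfolding hnn_stable_def HNN_def by (rule pres_class_closed) (simp add: hnn_gens_def)

lemma hnn_genset_closed: "hnn_genset G H \<phi> \<subseteq> carrier (HNN G H \<phi>)"
  unfolding hnn_genset_def
  by (intro Un_least image_subsetI insert_subsetI empty_subsetI hnn_base_closed hnn_stable_closed
      group.inv_closed[OF group_HNN])

lemma hnn_base_hom:
  assumes "group G"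
  shows "hnn_base G H \<phi> \<in> hom G (HNN G H \<phi>)"
proof (rule homI)
  interpret group G by fact
  fix g h assume gh: "g \<in> carrier G" "h \<in> carrier G"
  let ?l = "[(Base g, True), (Base h, True)]" and ?r = "[(Base (g \<otimes>\<^bsub>G\<^esub> h), True)]"
  have "(?l, ?r) \<in> hnn_rels G H \<phi>"
    unfolding hnn_rels_def using gh by blast
  then have "(?l, ?r) \<in> pres_rel (hnn_gens G) (hnn_rels G H \<phi>)"
    using gh pres_rel.relation[of ?l ?r "hnn_rels G H \<phi>" "[]" "[]" "hnn_gens G"]
    by (simp add: hnn_gens_def)
  then show "hnn_base G H \<phi> (g \<otimes>\<^bsub>G\<^esub> h) =
      hnn_base G H \<phi> g \<otimes>\<^bsub>HNN G H \<phi>\<^esub> hnn_base G H \<phi> h"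
    using gh pres_class_eq_iff[of "[(Base g, True), (Base h, True)]" "hnn_gens G"
        "[(Base (g \<otimes>\<^bsub>G\<^esub> h), True)]" "hnn_rels G H \<phi>"]
    by (simp add: hnn_base_def HNN_def mult_pres_class hnn_gens_def)
qed (rule hnn_base_closed)

lemma inv_hnn_stable:
  "inv\<^bsub>HNN G H \<phi>\<^esub> (hnn_stable G H \<phi>) =
    pres_class (hnn_gens G) (hnn_rels G H \<phi>) [(Stable, False)]"
proof -
  let ?S = "hnn_gens G" and ?R = "hnn_rels G H \<phi>"
  have S: "Stable \<in> ?S" by (simp add: hnn_gens_def)
  have "([(Stable, False), (Stable, True)], []) \<in> pres_rel ?S ?R"
    using pres_rel.cancel[OF S, of "[]" "[]" False ?R] by simp
  then have "pres_class ?S ?R [(Stable, False)] \<otimes>\<^bsub>HNN G H \<phi>\<^esub> hnn_stable G H \<phi>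
      = \<one>\<^bsub>HNN G H \<phi>\<^esub>"
    using S by (simp add: hnn_stable_def HNN_def mult_pres_class one_pres_group pres_class_eq_iff)
  moreover have "pres_class ?S ?R [(Stable, False)] \<in> carrier (HNN G H \<phi>)"
    unfolding HNN_def using S by (intro pres_class_closed) simp
  ultimately show ?thesis
    using group.inv_equality[OF group_HNN] hnn_stable_closed by metis
qed

lemma hnn_relation:
  assumes "h \<in> H" "H \<subseteq> carrier G" "\<phi> h \<in> carrier G"
  shows "inv\<^bsub>HNN G H \<phi>\<^esub> (hnn_stable G H \<phi>) \<otimes>\<^bsub>HNN G H \<phi>\<^esub> hnn_base G H \<phi> h
      \<otimes>\<^bsub>HNN G H \<phi>\<^esub> hnn_stable G H \<phi> = hnn_base G H \<phi> (\<phi> h)"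
proof -
  let ?l = "[(Stable, False), (Base h, True), (Stable, True)]" and ?r = "[(Base (\<phi> h), True)]"
  have "(?l, ?r) \<in> hnn_rels G H \<phi>"
    unfolding hnn_rels_def using assms(1) by blast
  moreover have "h \<in> carrier G" using assms by blast
  ultimately have "(?l, ?r) \<in> pres_rel (hnn_gens G) (hnn_rels G H \<phi>)"
    using assms(3) pres_rel.relation[of ?l ?r "hnn_rels G H \<phi>" "[]" "[]" "hnn_gens G"]
    by (simp add: hnn_gens_def)
  moreover have "Base h \<in> hnn_gens G" "Base (\<phi> h) \<in> hnn_gens G" "Stable \<in> hnn_gens G"
    using assms by (auto simp: hnn_gens_def)
  ultimately show ?thesis
    by (simp add: inv_hnn_stable)
      (simp add: hnn_base_def hnn_stable_def HNN_def mult_pres_class pres_class_eq_iff)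
qed

text \<open>Every element of the HNN extension is a finite product of almost palindromes, so an infinite
  width means that the lengths, all finite, are unbounded.\<close>

lemma hnn_letter_almost_palindrome:
  assumes "x \<in> hnn_genset G H1 \<phi>"
  shows "x \<in> almost_palindromes (HNN G H1 \<phi>) (hnn_genset G H1 \<phi>) (hnn_reduced G H1 H2 \<phi>) m"
proof -
  let ?K = "HNN G H1 \<phi>"
  interpret K: group ?K by (rule group_HNN)
  have "\<not> sublist (a # b # c) [x]" for a b c
    by (auto dest: sublist_length_le)
  then have "hnn_reduced G H1 H2 \<phi> [x]"
    by (simp add: hnn_reduced_def Let_def)
  then have "[x] \<in> palindromes ?K (hnn_genset G H1 \<phi>) (hnn_reduced G H1 H2 \<phi>)"
    using assms by (simp add: palindromes_def letters_def)
  moreover have "word_prod ?K [x] = x"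
    using assms hnn_genset_closed by (fastforce simp: word_prod_def)
  moreover have "letter_changes [x] [x] \<le> m"
    by (simp add: letter_changes_def)
  ultimately show ?thesis
    using assms unfolding almost_palindromes_def
    by (intro CollectI exI[of _ "[x]"] conjI bexI[of _ "[x]"]) (simp_all add: letters_def)
qed

lemma hnn_almost_pal_length_finite:
  assumes "group G" "g \<in> carrier (HNN G H1 \<phi>)"
  shows "almost_pal_length (HNN G H1 \<phi>) (hnn_genset G H1 \<phi>) (hnn_reduced G H1 H2 \<phi>) m g \<noteq> \<infinity>"
proof -
  let ?K = "HNN G H1 \<phi>" and ?S = "hnn_gens G" and ?R = "hnn_rels G H1 \<phi>"
  let ?P = "almost_palindromes ?K (hnn_genset G H1 \<phi>) (hnn_reduced G H1 H2 \<phi>) m"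
  interpret G: group G by fact
  interpret base: group_hom G ?K "hnn_base G H1 \<phi>"
    by (intro group_hom.intro group_hom_axioms.intro assms(1) group_HNN hnn_base_hom)
  have letter: "pres_class ?S ?R [(x, b)] \<in> hnn_genset G H1 \<phi>" if x: "x \<in> ?S" for x b
  proof (cases x)
    case Stable
    then show ?thesis
      by (cases b) (simp_all add: hnn_genset_def inv_hnn_stable, simp add: hnn_stable_def)
  next
    case (Base a)
    then have a: "a \<in> carrier G" using x by (auto simp: hnn_gens_def)
    show ?thesis
    proof (cases b)
      case True
      then show ?thesis using a Base by (auto simp: hnn_genset_def hnn_base_def)
    next
      case False
      have "([(Base a, False), (Base a, True)], []) \<in> pres_rel ?S ?R"
        using pres_rel.cancel[of x ?S "[]" "[]" False ?R] x Base by simp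
      then have "pres_class ?S ?R [(x, b)] \<otimes>\<^bsub>?K\<^esub> hnn_base G H1 \<phi> a = \<one>\<^bsub>?K\<^esub>"
        using x Base False
        by (simp add: hnn_base_def HNN_def mult_pres_class one_pres_group pres_class_eq_iff)
      moreover have "pres_class ?S ?R [(x, b)] \<in> carrier ?K"
        unfolding HNN_def using x by (intro pres_class_closed) simp
      ultimately have "pres_class ?S ?R [(x, b)] = hnn_base G H1 \<phi> (inv\<^bsub>G\<^esub> a)"
        using base.H.inv_equality a base.hom_inv hnn_base_closed by metis
      moreover have "hnn_base G H1 \<phi> (inv\<^bsub>G\<^esub> a) \<in> hnn_base G H1 \<phi> ` carrier G"
        using a by (intro imageI G.inv_closed)
      ultimately show ?thesis unfolding hnn_genset_def by (metis UnI1)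
    qed
  qed
  have "\<exists>ps\<in>lists ?P. word_prod ?K ps = pres_class ?S ?R w" if "w \<in> pwords ?S" for w
    using that
  proof (induction w rule: list.induct)
    case Nil
    then show ?case
      by (intro bexI[of _ "[]"]) (simp_all add: word_prod_def HNN_def one_pres_group)
  next
    case (Cons a w)
    obtain x b where a: "a = (x, b)" by force
    have x: "x \<in> ?S" "w \<in> pwords ?S" using Cons.prems a by auto
    obtain ps where ps: "ps \<in> lists ?P" "word_prod ?K ps = pres_class ?S ?R w"
      using Cons.IH x by blast
    have "pres_class ?S ?R [(x, b)] \<otimes>\<^bsub>?K\<^esub> pres_class ?S ?R w = pres_class ?S ?R (a # w)"
      using x mult_pres_class[of "[(x, b)]" ?S w ?R] by (simp add: HNN_def a)
    then have "word_prod ?K (pres_class ?S ?R [(x, b)] # ps) = pres_class ?S ?R (a # w)"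
      using ps by (simp add: word_prod_def)
    then show ?case
      using ps hnn_letter_almost_palindrome[OF letter[OF x(1), of b]]
      by (intro bexI[of _ "pres_class ?S ?R [(x, b)] # ps"]) simp_all
  qed
  then obtain ps where "ps \<in> lists ?P" "word_prod ?K ps = g"
    using assms(2) unfolding HNN_def carrier_pres_group by blast
  then have "almost_pal_length ?K (hnn_genset G H1 \<phi>) (hnn_reduced G H1 H2 \<phi>) m g
      \<le> enat (length ps)"
    unfolding almost_pal_length_def by (intro INF_lower) simp
  then show ?thesis using enat_ile by auto
qed

end

theory Submission
  imports Defs "HOL-Algebra.Coset"
begin

text \<open>The exponents \<open>e\<^sub>1, \<dots>, e\<^sub>n\<close> of \<open>t\<close> in a Britton-reduced word are determined by the group
  element. On sign sequences we count, in the manner of Brooks, the occurrences of a pattern and of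
  its negation minus those of their reverses. This count \<open>F\<close> is additive under concatenation up to a
  bounded error, satisfies \<open>F(rev e) = - F(e)\<close> and is invariant under negation. Hence
  \<open>F(e\<^sup>-\<^sup>1) = - F(e)\<close> for the formal inverse, so \<open>F\<close> is a quasimorphism on the HNN extension,
  and it vanishes on reduced palindromes. Changing a letter alters \<open>F\<close> by a bounded amount, so \<open>F\<close>
  is bounded on \<open>m\<close>-almost palindromes, and linearly bounded in the number of factors on their
  products; but \<open>F\<close> is unbounded as soon as both sign changes \<open>t g t\<^sup>-\<^sup>1\<close> and \<open>t\<^sup>-\<^sup>1 g t\<close> can occur
  without cancellation, that is, as soon as \<open>H\<^sub>1\<close> and \<open>H\<^sub>2\<close> are proper. Uniqueness of the exponents
  comes from van der Waerden's method: the HNN extension acts on normal forms.\<close>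

section \<open>A counting function on sign sequences\<close>

text \<open>For patterns of length at most 4 the analogous counting function is bounded.\<close>

definition pattern_weight :: "bool list \<Rightarrow> int"
  where "pattern_weight w =
    (if w \<in> {[False, True, False, False, True], [True, False, True, True, False]} then 1
     else if w \<in> {[True, False, False, True, False], [False, True, True, False, True]} then -1
     else 0)"

fun pattern_count :: "bool list \<Rightarrow> int" where
  "pattern_count [] = 0"
| "pattern_count (x # xs) = pattern_weight (take 5 (x # xs)) + pattern_count xs"

lemma pattern_weight_length: "length w \<noteq> 5 \<Longrightarrow> pattern_weight w = 0"
  by (auto simp: pattern_weight_def)

lemma pattern_weight_bounds: "- 1 \<le> pattern_weight w" "pattern_weight w \<le> 1"
  by (simp_all add: pattern_weight_def)

lemma pattern_weight_rev: "pattern_weight (rev w) = - pattern_weight w"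
  by (auto simp: pattern_weight_def rev_swap)

lemma map_Not_eq_iff: "map Not w = v \<longleftrightarrow> w = map Not v"
  by (auto simp: comp_def)

lemma pattern_weight_Not: "pattern_weight (map Not w) = pattern_weight w"
  by (auto simp: pattern_weight_def map_Not_eq_iff)

lemma pattern_count_Not: "pattern_count (map Not w) = pattern_count w"
proof (induction w)
  case (Cons a w)
  then show ?case
    using pattern_weight_Not[of "take 5 (a # w)"] by (simp add: take_map)
qed simp

text \<open>The recursion of \<open>pattern_count\<close> peels letters off the left; its mirror
  image on the right is what reversal needs. Appending a letter creates one new window, the last
  five letters.\<close>

lemma pattern_count_snoc:
  "pattern_count (ys @ [x]) = pattern_count ys + pattern_weight (rev (take 5 (x # rev ys)))"
proof (induction ys)
  case (Cons y ys)
  show ?case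
  proof (cases "length ys \<ge> 4")
    case True
    then have "take 5 (y # ys @ [x]) = take 5 (y # ys)"
      "take 5 (x # rev ys @ [y]) = take 5 (x # rev ys)"
      by (simp_all add: eval_nat_numeral)
    with Cons show ?thesis by simp
  next
    case False
    \<comment> \<open>With three inner letters the whole word is a single window, both first and
      last; with fewer, every weight is 0.\<close>
    show ?thesis
    proof (cases "length ys = 3")
      case True
      then have "pattern_weight (take 5 (y # ys)) = 0"
        "pattern_weight (rev (take 5 (x # rev ys))) = 0"
        by (simp_all add: pattern_weight_length)
      moreover have "take 5 (y # ys @ [x]) = rev (take 5 (x # rev ys @ [y]))"
        using True by (simp add: eval_nat_numeral)
      ultimately show ?thesis using Cons by simp
    next
      case neq: False
      then show ?thesis using Cons False by (simp add: pattern_weight_length min_def)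
    qed
  qed
qed (simp add: pattern_weight_length)

text \<open>The windows of the reversed word are the reversed windows, and the weight is odd under
  reversal.\<close>

lemma pattern_count_rev: "pattern_count (rev w) = - pattern_count w"
proof (induction w)
  case (Cons a w)
  then show ?case
    using pattern_count_snoc[of "rev w" a] pattern_weight_rev[of "take 5 (a # w)"] by simp
qed simp

text \<open>The error comes from the windows straddling the junction. The bound with
  \<open>min\<close> carries the induction: once \<open>xs\<close> has four letters, a further one
  on the left opens no straddling window.\<close>

lemma pattern_count_append_min:
  "\<bar>pattern_count (xs @ ys) - pattern_count xs - pattern_count ys\<bar> \<le> int (min (length xs) 4)"
proof (induction xs)
  case (Cons x xs)
  show ?case
  proof (cases "length xs \<ge> 4")
    case True
    then have "take 5 (x # xs @ ys) = take 5 (x # xs)"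
      by (simp add: eval_nat_numeral)
    with Cons True show ?thesis by simp
  next
    case False
    then have "pattern_weight (take 5 (x # xs)) = 0"
      by (simp add: pattern_weight_length)
    with Cons False pattern_weight_bounds[of "take 5 (x # xs @ ys)"] show ?thesis
      by (simp add: min_def split: if_splits)
  qed
qed simp

lemma pattern_count_append:
  "\<bar>pattern_count (xs @ ys) - pattern_count xs - pattern_count ys\<bar> \<le> 4"
  using pattern_count_append_min[of xs ys] by simp

lemma pattern_count_palindrome: "rev w = w \<Longrightarrow> pattern_count w = 0"
  using pattern_count_rev[of w] by simp

text \<open>The runs have the chiral lengths 1, 2, 3, 1, 2, 3, \dots.\<close>

fun chiral :: "bool \<Rightarrow> nat \<Rightarrow> bool list" where
  "chiral b 0 = []"
| "chiral b (Suc n) = [b, \<not> b, \<not> b, b, b, b] @ chiral (\<not> b) n"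

text \<open>The pattern \<open>[b, \<not> b, b, b, \<not> b]\<close> occurs once at each junction,
  as the last letter of a block and the first four of the next; \<open>n + 1\<close> blocks have
  \<open>n\<close> junctions.\<close>

lemma pattern_count_chiral: "pattern_count (chiral b (Suc n)) = int n"
proof (induction n arbitrary: b)
  case 0
  show ?case by (cases b) (simp_all add: pattern_weight_def)
next
  case (Suc n)
  have "pattern_count (chiral b (Suc (Suc n))) = 1 + pattern_count (chiral (\<not> b) (Suc n))"
    by (cases b) (simp_all add: pattern_weight_def eval_nat_numeral)
  then show ?case unfolding Suc.IH by simp
qed

text \<open>Here \<open>s\<close> is a stack, \<open>e\<close> the exponents acting on it and
  \<open>k\<close> the number of cancellations. The cancelled parts have equal counts by invariance
  under negation; three junctions cost 4 each.\<close>

lemma pattern_count_cancel: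
  assumes "take k s = map Not (take k e)"
  shows "\<bar>pattern_count (rev (drop k e) @ drop k s) - pattern_count s + pattern_count e\<bar> \<le> 12"
proof -
  have "pattern_count (take k s) = pattern_count (take k e)"
    by (simp add: assms pattern_count_Not)
  then show ?thesis
    using pattern_count_append[of "take k s" "drop k s"] pattern_count_append[of "take k e" "drop k e"]
      pattern_count_append[of "rev (drop k e)" "drop k s"] pattern_count_rev[of "drop k e"]
    by simp
qed


section \<open>The action on normal forms\<close>

locale hnn_data = group G for G :: "('a, 'b) monoid_scheme" (structure) +
  fixes H1 H2 :: "'a set" and \<phi> :: "'a \<Rightarrow> 'a"
  assumes subgroups: "subgroup H1 G" "subgroup H2 G"
    and iso: "\<phi> \<in> iso (G\<lparr>carrier := H1\<rparr>) (G\<lparr>carrier := H2\<rparr>)"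
begin

text \<open>With \<open>t\<^sup>e\<close> encoded by \<open>e = True\<close> for \<open>t\<close> and \<open>e = False\<close> for \<open>t\<^sup>-\<^sup>1\<close>, the relations read
  \<open>h t\<^sup>e = t\<^sup>e (conj_map e h)\<close> for \<open>h \<in> assoc e\<close>.\<close>

definition assoc :: "bool \<Rightarrow> 'a set"
  where "assoc e = (if e then H1 else H2)"

definition conj_map :: "bool \<Rightarrow> 'a \<Rightarrow> 'a"
  where "conj_map e = (if e then \<phi> else inv_into H1 \<phi>)"

lemma assoc_subgroup: "subgroup (assoc e) G"
  using subgroups by (simp add: assoc_def)

lemma assoc_carrier: "h \<in> assoc e \<Longrightarrow> h \<in> carrier G"
  using subgroup.mem_carrier[OF assoc_subgroup] .

lemma conj_map_iso: "conj_map e \<in> iso (G\<lparr>carrier := assoc e\<rparr>) (G\<lparr>carrier := assoc (\<not> e)\<rparr>)"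
proof (cases e)
  case True
  then show ?thesis using iso by (simp add: assoc_def conj_map_def)
next
  case False
  interpret H1: group "G\<lparr>carrier := H1\<rparr>"
    using subgroup.subgroup_is_group[OF subgroups(1)] is_group by blast
  show ?thesis using False H1.iso_set_sym[OF iso] by (simp add: assoc_def conj_map_def)
qed

lemma conj_map_mem: "h \<in> assoc e \<Longrightarrow> conj_map e h \<in> assoc (\<not> e)"
  using conj_map_iso[of e] by (auto simp: iso_def hom_def)

lemma conj_map_mult:
  "h \<in> assoc e \<Longrightarrow> k \<in> assoc e \<Longrightarrow> conj_map e (h \<otimes> k) = conj_map e h \<otimes> conj_map e k"
  using conj_map_iso[of e] by (auto simp: iso_def hom_def)

lemma conj_map_inverse: "h \<in> assoc e \<Longrightarrow> conj_map (\<not> e) (conj_map e h) = h"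
proof -
  assume h: "h \<in> assoc e"
  have "bij_betw \<phi> H1 H2" using iso by (simp add: iso_def)
  with h show ?thesis
    by (cases e) (auto simp: assoc_def conj_map_def bij_betw_def f_inv_into_f)
qed

lemma conj_map_carrier: "h \<in> assoc e \<Longrightarrow> conj_map e h \<in> carrier G"
  using conj_map_mem assoc_carrier by blast

text \<open>Left cosets are used because \<open>g = r h\<close> with \<open>h\<close> in
  \<open>assoc e\<close> gives \<open>g t^e = r t^e (conj_map e h)\<close>. The subgroup itself gets
  the representative \<open>\<one>\<close>, so that pushing and popping undo each other
  exactly.\<close>

definition rep :: "bool \<Rightarrow> 'a \<Rightarrow> 'a"
  where "rep e g = (if g \<in> assoc e then \<one> else SOME x. x \<in> g <# assoc e)"

lemma rep_mem:
  assumes "g \<in> carrier G"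
  shows "rep e g \<in> g <# assoc e"
proof -
  have "g \<in> g <# assoc e"
    using assms subgroup.one_closed[OF assoc_subgroup] by (force simp: l_coset_def)
  then have "(SOME x. x \<in> g <# assoc e) \<in> g <# assoc e" by (rule someI)
  moreover have "\<one> \<in> g <# assoc e" if "g \<in> assoc e"
    using that subgroup.m_inv_closed[OF assoc_subgroup, of g e] assms
    by (force simp: l_coset_def)
  ultimately show ?thesis by (simp add: rep_def)
qed

lemma rep_carrier: "g \<in> carrier G \<Longrightarrow> rep e g \<in> carrier G"
  using rep_mem[of g e] assoc_carrier by (auto simp: l_coset_def)

lemma rep_quotient:
  assumes "g \<in> carrier G"
  shows "inv (rep e g) \<otimes> g \<in> assoc e"
proof -
  obtain h where h: "h \<in> assoc e" "rep e g = g \<otimes> h"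
    using rep_mem[OF assms] by (auto simp: l_coset_def)
  have hc: "h \<in> carrier G" using h assoc_carrier by blast
  have "inv (rep e g) \<otimes> g = inv h"
    using assms hc by (simp add: h inv_mult_group m_assoc)
  then show ?thesis using h subgroup.m_inv_closed[OF assoc_subgroup] by simp
qed

lemma assoc_mult_iff:
  assumes "g \<in> carrier G" "h \<in> assoc e"
  shows "g \<otimes> h \<in> assoc e \<longleftrightarrow> g \<in> assoc e"
proof
  assume "g \<otimes> h \<in> assoc e"
  then have "g \<otimes> h \<otimes> inv h \<in> assoc e"
    using assms subgroup.m_closed[OF assoc_subgroup] subgroup.m_inv_closed[OF assoc_subgroup] by blast
  then show "g \<in> assoc e" using assms assoc_carrier by (simp add: m_assoc)
qed (use assms subgroup.m_closed[OF assoc_subgroup] in blast)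

lemma assoc_mult_iff':
  assumes "g \<in> carrier G" "h \<in> assoc e"
  shows "h \<otimes> g \<in> assoc e \<longleftrightarrow> g \<in> assoc e"
proof
  assume "h \<otimes> g \<in> assoc e"
  then have "inv h \<otimes> (h \<otimes> g) \<in> assoc e"
    using assms subgroup.m_closed[OF assoc_subgroup] subgroup.m_inv_closed[OF assoc_subgroup] by blast
  then show "g \<in> assoc e" using assms assoc_carrier by (simp add: m_assoc[symmetric])
qed (use assms subgroup.m_closed[OF assoc_subgroup] in blast)

lemma rep_mult:
  assumes "g \<in> carrier G" "h \<in> assoc e"
  shows "rep e (g \<otimes> h) = rep e g"
proof -
  have "(g \<otimes> h) <# assoc e = g <# assoc e"
  proof -
    have "g \<otimes> h \<in> g <# assoc e" using assms by (auto simp: l_coset_def)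
    then show ?thesis
      using l_repr_independence[OF _ assms(1) assoc_subgroup] by metis
  qed
  then show ?thesis using assoc_mult_iff[OF assms] by (simp add: rep_def)
qed

lemma rep_rep: "g \<in> carrier G \<Longrightarrow> rep e (rep e g) = rep e g"
  using rep_mem[of g e] rep_mult by (auto simp: l_coset_def)

lemma rep_one: "g \<in> assoc e \<Longrightarrow> rep e g = \<one>"
  by (simp add: rep_def)

lemma rep_assoc_iff: "g \<in> carrier G \<Longrightarrow> rep e g \<in> assoc e \<longleftrightarrow> g \<in> assoc e"
  using rep_mem[of g e] assoc_mult_iff by (auto simp: l_coset_def)

text \<open>The state \<open>(g, [(e\<^sub>n, r\<^sub>n), \<dots>, (e\<^sub>1, r\<^sub>1)])\<close> stands for the element
  \<open>r\<^sub>1 t\<^bsup>e\<^sub>1\<^esup> \<dots> r\<^sub>n t\<^bsup>e\<^sub>n\<^esup> g\<close>; \<open>step e\<close> is right multiplication by \<open>t\<^sup>e\<close>.\<close>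

definition cancels :: "bool \<Rightarrow> 'a \<times> (bool \<times> 'a) list \<Rightarrow> bool"
  where "cancels e x \<longleftrightarrow> fst x \<in> assoc e \<and> snd x \<noteq> [] \<and> fst (hd (snd x)) = (\<not> e)"

definition step :: "bool \<Rightarrow> 'a \<times> (bool \<times> 'a) list \<Rightarrow> 'a \<times> (bool \<times> 'a) list"
  where "step e x =
    (let r = rep e (fst x); k = conj_map e (inv r \<otimes> fst x) in
     if cancels e x then (snd (hd (snd x)) \<otimes> k, tl (snd x)) else (k, (e, r) # snd x))"

fun lact :: "'a hnn_gen \<times> bool \<Rightarrow> 'a \<times> (bool \<times> 'a) list \<Rightarrow> 'a \<times> (bool \<times> 'a) list" where
  "lact (Base a, b) x = (fst x \<otimes> (if b then a else inv a), snd x)"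
| "lact (Stable, b) x = step b x"

abbreviation wact :: "'a hnn_gen pword \<Rightarrow> 'a \<times> (bool \<times> 'a) list \<Rightarrow> 'a \<times> (bool \<times> 'a) list"
  where "wact \<equiv> fold lact"

text \<open>These are the normal forms. A representative \<open>r\<close> lying in
  \<open>assoc e\<close> equals \<open>\<one>\<close>, so the condition on \<open>cancels\<close>
  excludes adjacent \<open>t^-e t^e\<close>.\<close>

fun valid_stack :: "(bool \<times> 'a) list \<Rightarrow> bool" where
  "valid_stack [] \<longleftrightarrow> True"
| "valid_stack ((e, r) # s) \<longleftrightarrow> r \<in> carrier G \<and> rep e r = r \<and> \<not> cancels e (r, s) \<and> valid_stack s"

definition valid :: "'a \<times> (bool \<times> 'a) list \<Rightarrow> bool"
  where "valid x \<longleftrightarrow> fst x \<in> carrier G \<and> valid_stack (snd x)"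

lemma valid_step:
  assumes "valid x"
  shows "valid (step e x)"
proof -
  obtain g s where x: "x = (g, s)" by force
  have g: "g \<in> carrier G" "valid_stack s" using assms by (simp_all add: valid_def x)
  have k: "conj_map e (inv (rep e g) \<otimes> g) \<in> carrier G"
    using g rep_quotient conj_map_carrier by blast
  show ?thesis
  proof (cases "cancels e x")
    case True
    then obtain e' r' s' where "s = (e', r') # s'" by (auto simp: cancels_def x neq_Nil_conv)
    with True g k show ?thesis by (simp add: step_def valid_def x)
  next
    case False
    then have "\<not> cancels e (rep e g, s)" using g by (simp add: cancels_def x rep_assoc_iff)
    with False g k show ?thesis
      by (simp add: step_def valid_def x Let_def rep_carrier rep_rep)
  qed
qed

lemma valid_lact: "valid x \<Longrightarrow> l \<in> hnn_gens G \<times> UNIV \<Longrightarrow> valid (lact l x)"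
  by (induction l x rule: lact.induct) (simp_all add: valid_step, auto simp: hnn_gens_def valid_def)

lemma valid_wact: "valid x \<Longrightarrow> w \<in> pwords (hnn_gens G) \<Longrightarrow> valid (wact w x)"
  by (induction w arbitrary: x) (auto simp: valid_lact simp del: lact.simps)

text \<open>A push is undone by a pop since the pushed base lies in \<open>assoc (\<not> e)\<close>.
  A pop is undone by a push since the popped entry was in normal form.\<close>

lemma step_inverse:
  assumes "valid x"
  shows "step (\<not> e) (step e x) = x"
proof -
  obtain g s where x: "x = (g, s)" by force
  have g: "g \<in> carrier G" "valid_stack s" using assms by (simp_all add: valid_def x)
  define h where "h = inv (rep e g) \<otimes> g"
  have h: "h \<in> assoc e" using g rep_quotient by (simp add: h_def)
  have k: "conj_map e h \<in> assoc (\<not> e)" using h conj_map_mem by blast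
  have hc: "h \<in> carrier G" "conj_map e h \<in> carrier G" using h conj_map_carrier assoc_carrier by auto
  show ?thesis
  proof (cases "cancels e x")
    case True
    then obtain r s' where s: "s = (\<not> e, r) # s'" and ge: "g \<in> assoc e"
      by (auto simp: cancels_def x neq_Nil_conv)
    have r: "r \<in> carrier G" "rep (\<not> e) r = r" "\<not> cancels (\<not> e) (r, s')"
      using g by (simp_all add: s)
    have "h = g" using g by (simp add: h_def rep_one[OF ge])
    then have "step e x = (r \<otimes> conj_map e g, s')"
      using True by (simp add: step_def x s h_def[symmetric] Let_def)
    \<comment> \<open>Validity of the old stack prevents the return step from popping a second
      entry.\<close>
    moreover have "\<not> cancels (\<not> e) (r \<otimes> conj_map e g, s')"
      using r k by (simp add: cancels_def assoc_mult_iff \<open>h = g\<close>)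
    ultimately show ?thesis
      using r k hc \<open>h = g\<close> conj_map_inverse[OF h]
      by (simp add: step_def Let_def rep_mult m_assoc[symmetric] x s)
  next
    case False
    then have 1: "step e (g, s) = (conj_map e h, (e, rep e g) # s)"
      by (simp add: step_def x h_def Let_def)
    have "cancels (\<not> e) (step e (g, s))" using k by (simp add: 1 cancels_def)
    moreover have "rep e g \<otimes> h = g"
      using g rep_carrier by (simp add: h_def m_assoc[symmetric])
    ultimately show ?thesis
      using hc conj_map_inverse[OF h] by (simp add: 1 step_def[of "\<not> e"] rep_one[OF k] x)
  qed
qed

text \<open>Multiplying the base by \<open>h\<close> changes neither its coset nor whether a
  cancellation occurs; only the factor carried across \<open>t^e\<close> changes, and there
  \<open>conj_map e\<close> is multiplicative.\<close>

lemma step_assoc: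
  assumes "valid x" "h \<in> assoc e"
  shows "step e (lact (Base h, True) x) = lact (Base (conj_map e h), True) (step e x)"
proof -
  obtain g s where x: "x = (g, s)" by force
  have g: "g \<in> carrier G" "valid_stack s" using assms by (simp_all add: valid_def x)
  have hc: "h \<in> carrier G" using assms assoc_carrier by blast
  have c: "cancels e (g \<otimes> h, s) \<longleftrightarrow> cancels e (g, s)"
    using g assms by (simp add: cancels_def assoc_mult_iff)
  have q: "inv (rep e g) \<otimes> g \<in> assoc e" using g rep_quotient by blast
  have "inv (rep e g) \<otimes> (g \<otimes> h) = inv (rep e g) \<otimes> g \<otimes> h"
    using g hc rep_carrier by (simp add: m_assoc)
  then have k: "conj_map e (inv (rep e g) \<otimes> (g \<otimes> h)) = conj_map e (inv (rep e g) \<otimes> g) \<otimes> conj_map e h"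
    using conj_map_mult[OF q assms(2)] by simp
  show ?thesis
  proof (cases "cancels e x")
    case True
    then obtain r s' where s: "s = (\<not> e, r) # s'"
      by (auto simp: cancels_def x neq_Nil_conv)
    then have "r \<in> carrier G" using g by simp
    then show ?thesis
      using True c k q assms(2) g
      by (simp add: step_def x Let_def rep_mult s m_assoc conj_map_carrier)
  next
    case False
    then show ?thesis
      using c k assms(2) g by (simp add: step_def x Let_def rep_mult)
  qed
qed

lemma wact_cong:
  assumes "(u, v) \<in> pres_rel (hnn_gens G) (hnn_rels G H1 \<phi>)" "valid x"
  shows "wact u x = wact v x"
  using assms
proof (induction arbitrary: x rule: pres_rel.induct)
  case (cancel a u v b)
  have y: "valid (wact u x)" using cancel valid_wact by blast
  have "wact [(a, b), (a, \<not> b)] (wact u x) = wact u x"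
  proof (cases a)
    case (Base g)
    then have "g \<in> carrier G" using cancel.hyps by (auto simp: hnn_gens_def)
    then show ?thesis using y Base by (cases b) (simp_all add: valid_def m_assoc)
  next
    case Stable
    then show ?thesis using y by (simp add: step_inverse)
  qed
  then show ?case by simp
next
  case (relation l r u v)
  have "u \<in> pwords (hnn_gens G)" using relation by simp
  then have y: "valid (wact u x)" using relation.prems valid_wact by blast
  have "wact l (wact u x) = wact r (wact u x)"
    using relation.hyps(1) unfolding hnn_rels_def
  proof (elim UnE CollectE exE conjE)
    fix g h assume "(l, r) = ([(Base g, True), (Base h, True)], [(Base (g \<otimes> h), True)])"
      "g \<in> carrier G" "h \<in> carrier G"
    then show ?thesis using y by (simp add: valid_def m_assoc)
  next
    fix h assume *: "(l, r) = ([(Stable, False), (Base h, True), (Stable, True)],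
      [(Base (\<phi> h), True)])" "h \<in> H1"
    \<comment> \<open>\<open>h\<close> is carried across \<open>t\<close>, after which
      \<open>t^-1 t\<close> disappears by \<open>step_inverse\<close>.\<close>
    have "step True (lact (Base h, True) (step False (wact u x))) =
        lact (Base (conj_map True h), True) (step True (step False (wact u x)))"
      using * y by (intro step_assoc valid_step) (simp_all add: assoc_def)
    then show ?thesis using * step_inverse[OF y, of False] by (simp add: conj_map_def)
  qed
  then show ?case by simp
qed auto

section \<open>The induced right action of the HNN extension\<close>

definition kact :: "'a hnn_gen pword set \<Rightarrow> 'a \<times> (bool \<times> 'a) list \<Rightarrow> 'a \<times> (bool \<times> 'a) list"
  where "kact k = wact (SOME w. w \<in> k)"

abbreviation cls :: "'a hnn_gen pword \<Rightarrow> 'a hnn_gen pword set"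
  where "cls \<equiv> pres_class (hnn_gens G) (hnn_rels G H1 \<phi>)"

lemma kact_cls:
  assumes "w \<in> pwords (hnn_gens G)" "valid x"
  shows "kact (cls w) x = wact w x"
proof -
  have "w \<in> cls w" using assms by (auto simp: pres_class_def intro: pres_rel.refl)
  then have "(SOME w'. w' \<in> cls w) \<in> cls w" by (rule someI)
  then have "(w, SOME w'. w' \<in> cls w) \<in> pres_rel (hnn_gens G) (hnn_rels G H1 \<phi>)"
    by (simp add: pres_class_def)
  then show ?thesis using wact_cong assms by (simp add: kact_def)
qed

abbreviation HNN_ext :: "'a hnn_gen pword set monoid"
  where "HNN_ext \<equiv> HNN G H1 \<phi>"

lemma carrier_HNN_cls: "k \<in> carrier HNN_ext \<Longrightarrow> \<exists>w\<in>pwords (hnn_gens G). k = cls w"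
  by (auto simp: HNN_def carrier_pres_group)

lemma kact_mult:
  assumes "k \<in> carrier HNN_ext" "l \<in> carrier HNN_ext" "valid x"
  shows "kact (k \<otimes>\<^bsub>HNN_ext\<^esub> l) x = kact l (kact k x)"
proof -
  obtain u v where uv: "u \<in> pwords (hnn_gens G)" "k = cls u" "v \<in> pwords (hnn_gens G)" "l = cls v"
    using assms carrier_HNN_cls by metis
  have "u @ v \<in> pwords (hnn_gens G)" using uv by simp
  then show ?thesis
    using uv assms(3) valid_wact by (simp add: HNN_def mult_pres_class kact_cls)
qed

lemma kact_word_prod:
  assumes "set ks \<subseteq> carrier HNN_ext" "valid x"
  shows "kact (word_prod HNN_ext ks) x = fold kact ks x \<and> word_prod HNN_ext ks \<in> carrier HNN_ext
    \<and> valid (fold kact ks x)"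
  using assms
proof (induction ks arbitrary: x)
  case Nil
  have "\<one>\<^bsub>HNN_ext\<^esub> = cls []" by (simp add: HNN_def one_pres_group)
  then show ?case
    using Nil kact_cls[of "[]" x] monoid.one_closed[OF group.is_monoid[OF group_HNN[of G H1 \<phi>]]]
    by (simp add: word_prod_def)
next
  case (Cons k ks)
  have k: "k \<in> carrier HNN_ext" using Cons.prems by simp
  then have "valid (kact k x)"
    using carrier_HNN_cls[OF k] Cons.prems kact_cls valid_wact by metis
  from Cons.IH[OF _ this] show ?case
    using Cons.prems kact_mult[of k "word_prod HNN_ext ks" x]
      group.is_monoid[OF group_HNN[of G H1 \<phi>]]
    by (simp add: word_prod_def monoid.m_closed)
qed


section \<open>Signatures of reduced words\<close>

text \<open>The stack is read from its top, so the exponents appear in reverse order.\<close>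

definition sig :: "'a \<times> (bool \<times> 'a) list \<Rightarrow> bool list"
  where "sig x = map fst (snd x)"

text \<open>Inverses of base letters are again base letters, so one sign suffices for them; this
  matches the letters of the generating set.\<close>

definition std_letters :: "('a hnn_gen \<times> bool) set"
  where "std_letters = (\<lambda>g. (Base g, True)) ` carrier G \<union> {(Stable, True), (Stable, False)}"

fun letter_exps :: "'a hnn_gen \<times> bool \<Rightarrow> bool list" where
  "letter_exps (Base g, b) = []"
| "letter_exps (Stable, b) = [b]"

definition exps :: "'a hnn_gen pword \<Rightarrow> bool list"
  where "exps w = concat (map letter_exps w)"

lemma exps_simps [simp]:
  "exps [] = []" "exps ((Base g, b) # w) = exps w" "exps ((Stable, b) # w) = b # exps w"
  "exps (u @ v) = exps u @ exps v"
  by (simp_all add: exps_def)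

lemma exps_rev: "exps (rev w) = rev (exps w)"
proof (induction w)
  case (Cons l w)
  then show ?case by (cases l rule: letter_exps.cases) simp_all
qed simp

text \<open>The formal counterpart of \<open>hnn_reduced\<close>, with the symmetric conditions for
  \<open>t\<close> and \<open>t^-1\<close> merged by quantifying over \<open>e\<close>.\<close>

definition britton :: "'a hnn_gen pword \<Rightarrow> bool"
  where "britton w \<longleftrightarrow>
    (\<forall>g\<in>carrier G. \<forall>h\<in>carrier G. \<not> sublist [(Base g, True), (Base h, True)] w) \<and>
    (\<forall>e. \<not> sublist [(Stable, e), (Stable, \<not> e)] w) \<and>
    (\<forall>e. \<forall>h\<in>assoc (\<not> e). \<not> sublist [(Stable, e), (Base h, True), (Stable, \<not> e)] w)"

lemma britton_sublist: "britton w \<Longrightarrow> sublist v w \<Longrightarrow> britton v"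
  unfolding britton_def by (meson sublist_order.order.trans)

lemma britton_Cons: "britton (l # w) \<Longrightarrow> britton w"
  by (rule britton_sublist) (auto simp: sublist_Cons_right)

lemma std_letters_gens: "l \<in> std_letters \<Longrightarrow> l \<in> hnn_gens G \<times> UNIV"
  by (auto simp: std_letters_def hnn_gens_def)

lemma step_push:
  assumes "valid x" "\<not> cancels e x"
  shows "\<exists>k r. step e x = (k, (e, r) # snd x) \<and> k \<in> assoc (\<not> e)"
  using assms rep_quotient[of "fst x" e] conj_map_mem by (simp add: step_def Let_def valid_def)

text \<open>The core of Britton's lemma: after one push, a reduced word never cancels again. The
  base \<open>h\<close> left by a push lies in \<open>assoc (\<not> e)\<close>, so for a base letter
  \<open>g\<close> outside it \<open>h g\<close> stays outside. Induction is on length since a base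
  letter and the next stable letter are consumed together.\<close>

lemma sig_push:
  assumes "britton ((Stable, e) # w)" "set w \<subseteq> std_letters" "valid (h, (e, r) # s)"
    "h \<in> assoc (\<not> e)"
  shows "sig (wact w (h, (e, r) # s)) = rev (exps w) @ e # map fst s"
  using assms
proof (induction "length w" arbitrary: w e h r s rule: less_induct)
  case less
  note x = less.prems(3)
  have push: "sig (wact w' (step e' (h', (e, r) # s))) = rev (exps w') @ e' # e # map fst s"
    if shorter: "length w' < length w" "britton ((Stable, e') # w')" "set w' \<subseteq> std_letters"
      and state: "valid (h', (e, r) # s)" "\<not> cancels e' (h', (e, r) # s)" for w' e' h'
  proof -
    obtain k r' where "step e' (h', (e, r) # s) = (k, (e', r') # (e, r) # s)" "k \<in> assoc (\<not> e')"
      using step_push[OF state] by auto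
    then show ?thesis
      using less.hyps[OF shorter, of k r' "(e, r) # s"] valid_step[OF state(1), of e'] by simp
  qed
  show ?case
  proof (cases w)
    case Nil
    then show ?thesis by (simp add: sig_def)
  next
    case (Cons l w')
    have tl: "set w' \<subseteq> std_letters" "l \<in> std_letters" using less.prems(2) Cons by auto
    from tl(2) consider b where "l = (Stable, b)" | g where "l = (Base g, True)" "g \<in> carrier G"
      unfolding std_letters_def by blast
    then show ?thesis
    proof cases
      case 1
      have "b \<noteq> (\<not> e)" using less.prems(1) by (auto simp: britton_def Cons 1 sublist_Cons_right)
      then have "b = e" by simp
      then show ?thesis
        using push[of w' e h] tl x britton_Cons[OF less.prems(1)] by (simp add: Cons 1 cancels_def)
    next
      case 2
      show ?thesis
      proof (cases w')
        case Nil
        then show ?thesis by (simp add: Cons 2 sig_def)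
      next
        case tail: (Cons l' w'')
        have y: "valid (h \<otimes> g, (e, r) # s)" using x 2 by (simp add: valid_def)
        have tl': "set w'' \<subseteq> std_letters" "l' \<in> std_letters" using tl tail by auto
        \<comment> \<open>Two base letters are never adjacent, so the next one is stable.\<close>
        from tl'(2) obtain b where l': "l' = (Stable, b)"
          using less.prems(1) by (auto simp: std_letters_def britton_def Cons 2 tail sublist_Cons_right)
        have "\<not> cancels b (h \<otimes> g, (e, r) # s)"
        proof (cases "b = e")
          case False
          then have b: "b = (\<not> e)" by simp
          have "sublist [(Stable, e), (Base g, True), (Stable, \<not> e)] ((Stable, e) # w)"
            by (simp add: Cons 2 tail l' b sublist_Cons_right)
          then have "g \<notin> assoc (\<not> e)"
            using less.prems(1) unfolding britton_def by blast
          then show ?thesis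
            using 2(2) less.prems(4) by (simp add: b cancels_def assoc_mult_iff')
        qed (simp add: cancels_def)
        moreover have "britton ((Stable, b) # w'')"
          using less.prems(1) britton_Cons unfolding Cons tail l' by blast
        ultimately show ?thesis
          using push[of w'' b "h \<otimes> g"] tl' y
          by (simp add: Cons 2 tail l')
      qed
    qed
  qed
qed

text \<open>A reduced word first cancels some \<open>k\<close> entries; from its first push on,
  \<open>sig_push\<close> says that all remaining exponents are pushed.\<close>

lemma sig_wact:
  assumes "britton w" "set w \<subseteq> std_letters" "valid x"
  shows "\<exists>k. take k (sig x) = map Not (take k (exps w)) \<and>
    sig (wact w x) = rev (drop k (exps w)) @ drop k (sig x)"
  using assms
proof (induction w arbitrary: x)
  case Nil
  then show ?case by (intro exI[of _ 0]) simp
next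
  case (Cons l w)
  have w: "britton w" "set w \<subseteq> std_letters" using Cons.prems britton_Cons by auto
  have "l \<in> std_letters" using Cons.prems by simp
  then have y: "valid (lact l x)" using Cons.prems valid_lact std_letters_gens by blast
  from \<open>l \<in> std_letters\<close> consider e where "l = (Stable, e)" | g where "l = (Base g, True)"
    unfolding std_letters_def by blast
  then show ?case
  proof cases
    case 1
    show ?thesis
    proof (cases "cancels e x")
      case True
      then have "sig x = (\<not> e) # sig (lact l x)"
        by (cases x; cases "snd x") (auto simp: 1 cancels_def step_def sig_def Let_def)
      moreover obtain k where "take k (sig (lact l x)) = map Not (take k (exps w))"
        "sig (wact w (lact l x)) = rev (drop k (exps w)) @ drop k (sig (lact l x))"
        using Cons.IH[OF w y] by blast
      ultimately show ?thesis by (intro exI[of _ "Suc k"]) (simp add: 1)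
    next
      case False
      then obtain k r where k: "step e x = (k, (e, r) # snd x)" "k \<in> assoc (\<not> e)"
        using step_push Cons.prems(3) by blast
      have "sig (wact w (k, (e, r) # snd x)) = rev (exps w) @ e # map fst (snd x)"
        using Cons.prems(1) w k y by (intro sig_push) (simp_all add: 1)
      then show ?thesis by (intro exI[of _ 0]) (simp add: 1 k sig_def)
    qed
  next
    case 2
    then have "sig (lact l x) = sig x" by (simp add: sig_def)
    with Cons.IH[OF w y] show ?thesis by (simp add: 2 del: lact.simps)
  qed
qed

section \<open>Change of height under reduced words\<close>

definition height :: "'a \<times> (bool \<times> 'a) list \<Rightarrow> int"
  where "height x = pattern_count (sig x)"

lemma height_wact:
  assumes "britton w" "set w \<subseteq> std_letters" "valid x"
  shows "\<bar>height (wact w x) - height x + pattern_count (exps w)\<bar> \<le> 12"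
  using sig_wact[OF assms] pattern_count_cancel unfolding height_def by metis

lemma britton_singleton: "britton [l]"
  by (auto simp: britton_def dest: sublist_length_le)

lemma pattern_count_letter: "pattern_count (exps [l]) = 0"
  by (cases l rule: letter_exps.cases) (simp_all add: pattern_weight_length)


section \<open>Almost palindromes\<close>

text \<open>Here \<open>map f w\<close> need not be reduced, so it is cut at each changed letter,
  with \<open>u\<close> collecting the unchanged letters since the last cut. A cut costs 12 for
  \<open>u\<close>, 12 for the single changed letter and 8 for two junctions in the count of
  \<open>p\<close>, in total 32; the last piece costs 12.\<close>

lemma height_wact_changes:
  fixes f :: "'c \<Rightarrow> 'a hnn_gen \<times> bool"
  assumes "length w = length p" "britton (u @ map f p)" "f ` (set w \<union> set p) \<subseteq> std_letters"
    "set u \<subseteq> std_letters" "valid x"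
  shows "\<bar>height (wact (u @ map f w) x) - height x + pattern_count (exps (u @ map f p))\<bar>
    \<le> 12 + 32 * int (letter_changes w p)"
  using assms
proof (induction w p arbitrary: u x rule: list_induct2)
  case Nil
  then show ?case using height_wact[of u x] by (simp add: letter_changes_def)
next
  case (Cons a w b p)
  have changes: "letter_changes (a # w) (b # p) = (if a = b then 0 else 1) + letter_changes w p"
  proof -
    have "{i. i < length (a # w) \<and> (a # w) ! i \<noteq> (b # p) ! i} =
        (if a = b then {} else {0}) \<union> Suc ` {i. i < length w \<and> w ! i \<noteq> p ! i}"
      by (auto simp: less_Suc_eq_0_disj)
    then show ?thesis by (simp add: letter_changes_def card_image)
  qed
  show ?case
  proof (cases "a = b")
    case True
    then show ?thesis using Cons.IH[of "u @ [f a]" x] Cons.prems changes by simp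
  next
    case False
    let ?y = "wact u x" and ?z = "wact [f a] (wact u x)"
    have l: "f a \<in> std_letters" "u \<in> pwords (hnn_gens G)"
      using Cons.prems std_letters_gens by auto
    have y: "valid ?y" using Cons.prems l valid_wact by blast
    then have z: "valid ?z" using l valid_lact std_letters_gens by simp
    have b: "britton u" "britton (map f p)"
      using Cons.prems(1) by (auto elim!: britton_sublist simp: sublist_append sublist_Cons_right)
    have "\<bar>height (wact (map f w) ?z) - height ?z + pattern_count (exps (map f p))\<bar>
        \<le> 12 + 32 * int (letter_changes w p)"
      using Cons.IH[of "[]" ?z] b z Cons.prems by simp
    moreover have "\<bar>height ?z - height ?y\<bar> \<le> 12"
      using height_wact[OF britton_singleton _ y, of "f a"] l by (simp add: pattern_count_letter)
    moreover have "\<bar>height ?y - height x + pattern_count (exps u)\<bar> \<le> 12"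
      using height_wact b Cons.prems by simp
    moreover have "\<bar>pattern_count (exps (u @ map f (b # p))) - pattern_count (exps u)
        - pattern_count (exps (map f p))\<bar> \<le> 8"
      using pattern_count_append[of "exps u" "exps [f b] @ exps (map f p)"]
        pattern_count_append[of "exps [f b]" "exps (map f p)"] pattern_count_letter[of "f b"]
      by (simp add: exps_def)
    ultimately show ?thesis by (simp add: changes False)
  qed
qed

section \<open>Formal letters representing generators\<close>

definition std_letter :: "'a hnn_gen pword set \<Rightarrow> 'a hnn_gen \<times> bool"
  where "std_letter k = (SOME l. l \<in> std_letters \<and> cls [l] = k)"

lemma cls_Base: "cls [(Base g, True)] = hnn_base G H1 \<phi> g"
  by (simp add: hnn_base_def)

lemma cls_Stable:
  "cls [(Stable, True)] = hnn_stable G H1 \<phi>"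
  "cls [(Stable, False)] = inv\<^bsub>HNN_ext\<^esub> (hnn_stable G H1 \<phi>)"
  by (simp_all add: inv_hnn_stable) (simp add: hnn_stable_def)

lemma letters_cls: "letters HNN_ext (hnn_genset G H1 \<phi>) = (\<lambda>l. cls [l]) ` std_letters"
proof -
  interpret K: group HNN_ext by (rule group_HNN)
  interpret b: group_hom G HNN_ext "hnn_base G H1 \<phi>"
    by (intro group_hom.intro group_hom_axioms.intro is_group group_HNN hnn_base_hom)
  have "(\<lambda>x. inv\<^bsub>HNN_ext\<^esub> x) ` hnn_genset G H1 \<phi> \<subseteq> hnn_genset G H1 \<phi>"
    unfolding hnn_genset_def
    by (auto simp: b.hom_inv[symmetric] hnn_stable_closed simp del: b.hom_inv)
  then have "letters HNN_ext (hnn_genset G H1 \<phi>) = hnn_genset G H1 \<phi>"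
    by (auto simp: letters_def)
  then show ?thesis
    by (simp add: hnn_genset_def std_letters_def image_Un image_image cls_Base cls_Stable)
qed

lemma std_letter:
  assumes "k \<in> letters HNN_ext (hnn_genset G H1 \<phi>)"
  shows "std_letter k \<in> std_letters" "cls [std_letter k] = k"
proof -
  have "\<exists>l. l \<in> std_letters \<and> cls [l] = k" using assms by (auto simp: letters_cls)
  then have "std_letter k \<in> std_letters \<and> cls [std_letter k] = k"
    unfolding std_letter_def by (rule someI_ex)
  then show "std_letter k \<in> std_letters" "cls [std_letter k] = k" by auto
qed

lemma word_prod_cls: "set w \<subseteq> std_letters \<Longrightarrow> word_prod HNN_ext (map (\<lambda>l. cls [l]) w) = cls w"
proof (induction w)
  case (Cons l w)
  then have "[l] \<in> pwords (hnn_gens G)" "w \<in> pwords (hnn_gens G)"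
    using std_letters_gens by auto
  from mult_pres_class[OF this] Cons show ?case
    by (simp add: word_prod_def HNN_def)
qed (simp add: word_prod_def HNN_def one_pres_group)

text \<open>Taking classes letter by letter turns a forbidden formal subword into a forbidden
  subword of group elements.\<close>

lemma britton_if_hnn_reduced:
  assumes "hnn_reduced G H1 H2 \<phi> (map (\<lambda>l. cls [l]) w)"
  shows "britton w"
proof -
  have *: "sublist (map (\<lambda>l. cls [l]) v) (map (\<lambda>l. cls [l]) w)" if "sublist v w" for v
    using that by (rule map_mono_sublist)
  have "\<not> sublist [(Stable, e), (Stable, \<not> e)] w" for e
    using assms * [of "[(Stable, e), (Stable, \<not> e)]"]
    by (cases e) (auto simp: hnn_reduced_def Let_def cls_Stable)
  moreover have "\<not> sublist [(Stable, e), (Base h, True), (Stable, \<not> e)] w" if "h \<in> assoc (\<not> e)" for e h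
    using assms that * [of "[(Stable, e), (Base h, True), (Stable, \<not> e)]"]
    by (cases e) (auto simp: hnn_reduced_def Let_def cls_Stable cls_Base assoc_def)
  moreover have "\<not> sublist [(Base g, True), (Base h, True)] w"
    if "g \<in> carrier G" "h \<in> carrier G" for g h
    using assms that * [of "[(Base g, True), (Base h, True)]"]
    by (auto simp: hnn_reduced_def Let_def cls_Base)
  ultimately show ?thesis unfolding britton_def by blast
qed

abbreviation almost_pals :: "nat \<Rightarrow> 'a hnn_gen pword set set"
  where "almost_pals m \<equiv>
    almost_palindromes HNN_ext (hnn_genset G H1 \<phi>) (hnn_reduced G H1 H2 \<phi>) m"

lemma height_almost_palindrome:
  assumes "k \<in> almost_pals m" "valid x"
  shows "k \<in> carrier HNN_ext" "\<bar>height (kact k x) - height x\<bar> \<le> 12 + 32 * int m"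
proof -
  let ?L = "letters HNN_ext (hnn_genset G H1 \<phi>)"
  obtain w p where k: "k = word_prod HNN_ext w" and w: "w \<in> lists ?L" and p: "p \<in> lists ?L"
    and red: "hnn_reduced G H1 H2 \<phi> p" and pal: "rev p = p"
    and len: "length p = length w" and ch: "letter_changes w p \<le> m"
    using assms(1) by (auto simp: almost_palindromes_def palindromes_def)
  have std: "set (map std_letter w) \<subseteq> std_letters" "std_letter ` (set w \<union> set p) \<subseteq> std_letters"
    using w p std_letter(1) by auto
  have cls_std: "map (\<lambda>l. cls [l]) (map std_letter v) = v" if "v \<in> lists ?L" for v
    using that std_letter(2) by (induction v) auto
  have kw: "k = cls (map std_letter w)"
    using word_prod_cls[OF std(1)] cls_std[OF w] k by simp
  have pw: "map std_letter w \<in> pwords (hnn_gens G)"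
    using std(1) std_letters_gens by blast
  show "k \<in> carrier HNN_ext"
    unfolding kw HNN_def using pw by (rule pres_class_closed)
  have "britton (map std_letter p)"
    using britton_if_hnn_reduced cls_std[OF p] red by simp
  \<comment> \<open>Formal letters are chosen as a function of the group element, so the formal word
    and its exponents are palindromes too.\<close>
  moreover have "pattern_count (exps (map std_letter p)) = 0"
    using pattern_count_palindrome[of "exps (map std_letter p)"] exps_rev[of "map std_letter p"] pal
    by (simp add: rev_map)
  ultimately have "\<bar>height (wact (map std_letter w) x) - height x\<bar> \<le> 12 + 32 * int (letter_changes w p)"
    using height_wact_changes[of w p "[]" std_letter x] std(2) len assms(2) by simp
  with ch show "\<bar>height (kact k x) - height x\<bar> \<le> 12 + 32 * int m"
    using kact_cls[OF pw assms(2)] kw by simp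
qed

lemma height_product:
  assumes "ks \<in> lists (almost_pals m)" "valid x"
  shows "\<bar>height (kact (word_prod HNN_ext ks) x) - height x\<bar> \<le> int (length ks) * (12 + 32 * int m)"
proof -
  have c: "set ks \<subseteq> carrier HNN_ext"
    using assms height_almost_palindrome(1) by blast
  have "\<bar>height (fold kact ks x) - height x\<bar> \<le> int (length ks) * (12 + 32 * int m)"
    using assms c
  proof (induction ks arbitrary: x rule: list.induct)
    case (Cons k ks)
    have "valid (kact k x)"
      using kact_word_prod[of "[k]" x] Cons.prems by simp
    then have "\<bar>height (fold kact ks (kact k x)) - height (kact k x)\<bar> \<le> int (length ks) * (12 + 32 * int m)"
      using Cons by simp
    moreover have "\<bar>height (kact k x) - height x\<bar> \<le> 12 + 32 * int m"
      using Cons.prems(1,2) by (intro height_almost_palindrome(2)) simp_all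
    ultimately show ?case by (simp add: algebra_simps)
  qed simp
  then show ?thesis using kact_word_prod[OF c assms(2)] by simp
qed


section \<open>Elements of unbounded height\<close>

text \<open>After \<open>t^e\<close> the base lies in \<open>assoc (\<not> e)\<close>, and the
  factor \<open>a (\<not> e)\<close> moves it outside. Hence neither sign of the next stable letter
  cancels, and any sign sequence can be realised.\<close>

lemma sig_alternating:
  assumes a: "\<And>e. a e \<in> carrier G - assoc e" and "valid x"
    and "snd x = [] \<or> fst x \<notin> assoc (\<not> fst (hd (snd x)))"
  shows "sig (wact (concat (map (\<lambda>e. [(Stable, e), (Base (a (\<not> e)), True)]) es)) x) = rev es @ sig x"
  using assms(2,3)
proof (induction es arbitrary: x)
  case (Cons e es)
  have "\<not> cancels e x" using Cons.prems(2) by (cases e) (auto simp: cancels_def)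
  then obtain k r where k: "step e x = (k, (e, r) # snd x)" "k \<in> assoc (\<not> e)"
    using step_push Cons.prems(1) by blast
  have ae: "a (\<not> e) \<in> carrier G" "a (\<not> e) \<notin> assoc (\<not> e)" using a by auto
  let ?y = "(k \<otimes> a (\<not> e), (e, r) # snd x)"
  have "valid ?y"
    using valid_step[OF Cons.prems(1), of e] ae by (simp add: k valid_def)
  moreover have "k \<otimes> a (\<not> e) \<notin> assoc (\<not> e)"
    using ae k by (simp add: assoc_mult_iff')
  ultimately show ?case using Cons.IH[of ?y] by (simp add: k sig_def)
qed simp

lemma ex_height:
  assumes "H1 \<noteq> carrier G" "H2 \<noteq> carrier G"
  shows "\<exists>k\<in>carrier HNN_ext. \<bar>height (kact k (\<one>, []))\<bar> = int n"
proof -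
  \<comment> \<open>Both subgroups being proper supplies a blocking factor for either sign
    change.\<close>
  have "\<exists>g. g \<in> carrier G - assoc e" for e
    using assms subgroups[THEN subgroup.subset] by (cases e) (auto simp: assoc_def)
  then obtain a where a: "a e \<in> carrier G - assoc e" for e by metis
  let ?w = "concat (map (\<lambda>e. [(Stable, e), (Base (a (\<not> e)), True)]) (chiral True (Suc n)))"
  have w: "?w \<in> pwords (hnn_gens G)"
    using a by (auto simp: hnn_gens_def simp del: chiral.simps)
  have v: "valid (\<one>, [])" by (simp add: valid_def)
  have "sig (wact ?w (\<one>, [])) = rev (chiral True (Suc n))"
    using sig_alternating[OF a v, of "chiral True (Suc n)"] by (simp add: sig_def del: chiral.simps)
  then have "height (kact (cls ?w) (\<one>, [])) = - int n"
    unfolding kact_cls[OF w v] height_def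
    by (simp only: pattern_count_rev pattern_count_chiral)
  moreover have "cls ?w \<in> carrier HNN_ext"
    unfolding HNN_def using w by (rule pres_class_closed)
  ultimately show ?thesis by (intro bexI[of _ "cls ?w"]) simp_all
qed

lemma almost_pal_width_infinite:
  assumes "H1 \<noteq> carrier G" "H2 \<noteq> carrier G"
  shows "almost_pal_width HNN_ext (hnn_genset G H1 \<phi>) (hnn_reduced G H1 H2 \<phi>) m = \<infinity>"
proof (rule ccontr)
  assume "\<not> ?thesis"
  then obtain N where N: "almost_pal_width HNN_ext (hnn_genset G H1 \<phi>) (hnn_reduced G H1 H2 \<phi>) m = enat N"
    by auto
  let ?B = "12 + 32 * m"
  \<comment> \<open>Each factor changes the height by at most \<open>?B\<close>, so this height
    forces at least \<open>Suc N\<close> factors.\<close>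
  obtain k where k: "k \<in> carrier HNN_ext" "\<bar>height (kact k (\<one>, []))\<bar> = int (Suc N * ?B)"
    using ex_height[OF assms, of "Suc N * ?B"] by metis
  have "enat (Suc N) \<le> almost_pal_length HNN_ext (hnn_genset G H1 \<phi>) (hnn_reduced G H1 H2 \<phi>) m k"
    unfolding almost_pal_length_def
  proof (rule INF_greatest)
    fix ks assume "ks \<in> {ks \<in> lists (almost_pals m). word_prod HNN_ext ks = k}"
    then have ks: "ks \<in> lists (almost_pals m)" "word_prod HNN_ext ks = k" by auto
    have "height (\<one>, []) = 0" by (simp add: height_def sig_def)
    then have "int (Suc N * ?B) \<le> int (length ks) * (12 + 32 * int m)"
      using height_product[OF ks(1), of "(\<one>, [])"] k by (simp add: ks(2) valid_def)
    also have "\<dots> = int (length ks * ?B)" by simp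
    finally have "Suc N * ?B \<le> length ks * ?B" by linarith
    then have "Suc N \<le> length ks" by (subst (asm) mult_le_cancel2) simp
    then show "enat (Suc N) \<le> enat (length ks)" by simp
  qed
  also have "\<dots> \<le> enat N"
    unfolding N[symmetric] almost_pal_width_def using k(1) by (intro SUP_upper)
  finally show False by simp
qed

end

theorem theorem1p2:
  fixes G :: "('a, 'b) monoid_scheme" and H1 H2 :: "'a set" and \<phi> :: "'a \<Rightarrow> 'a" and m :: nat
  assumes "group G"
    and "subgroup H1 G" "H1 \<noteq> carrier G"
    and "subgroup H2 G" "H2 \<noteq> carrier G"
    and "\<phi> \<in> iso (G\<lparr>carrier := H1\<rparr>) (G\<lparr>carrier := H2\<rparr>)"
  shows "almost_pal_width (HNN G H1 \<phi>) (hnn_genset G H1 \<phi>) (hnn_reduced G H1 H2 \<phi>) m = \<infinity>"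
proof -
  interpret hnn_data G H1 H2 \<phi>
    using assms by (intro hnn_data.intro hnn_data_axioms.intro)
  show ?thesis using assms(3,5) by (rule almost_pal_width_infinite)
qed

end
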